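(* Let $a,b,c,k,l,m$ be positive integers with $c\mid ab$ and $k,l\ge m$, let $h=\frac{a^kb^l}{c^m}$ (a positive integer), and let $d_i^{\pm}=a^{2k}b^{2l}\pm i c^m$ for $i=1,2$, where each $d_i^\pm$ under consideration is a square-free positive integer. Let $F_{\Delta_d}=(1,0,-d)$ denote the form $x^2-dy^2$ and $\rho^2(F_{\Delta_d})$ its reduction. Then: the proper cycle of $\rho^2(F_{\Delta_{d_1^+}})$ is $(1,2hc^m,-c^m)\sim(-c^m,2hc^m,1)$, of length $2$; the proper cycle of $\rho^2(F_{\Delta_{d_2^+}})$ is $(1,2hc^m,-2c^m)\sim(2c^m,2hc^m,-1)$, of length $2$; the proper cycle of $\rho^2(F_{\Delta_{d_1^-}})$ is $(1,2hc^m-2,1-(2h-1)c^m)\sim(-2hc^m+c^m+1,(2h-1)c^m,c^m)\sim(-c^m,2hc^m-2c^m,2hc^m-c^m-1)\sim(-2hc^m+c^m+1,2hc^m-2,1)$, of length $4$; the proper cycle of $\rho^2(F_{\Delta_{d_2^-}})$ is $(1,2hc^m-2,1-2(h-1)c^m)\sim(-2hc^m+2c^m+1,2(h-2)c^m,2c^m)\sim(-2c^m,2hc^m-4c^m,2hc^m-2c^m-1)\sim(-2hc^m+2c^m+1,2hc^m-4,1)$, of length $4$.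
   Context: $(A,B,C)$ denotes the binary quadratic form $Ax^2+Bxy+Cy^2$, of discriminant $\Delta=B^2-4AC$, and $\tau(A,B,C)=(-A,B,-C)$. An indefinite form ($\Delta>0$) is reduced if $|\sqrt\Delta-2|A||<B<\sqrt\Delta$. For an indefinite form $F$ write $\rho^0(F)=F$ and $\rho^j(F)=(a_j,b_j,c_j)$; then $\rho^{j+1}(F)=(c_j,-b_j+2c_jr_j,c_jr_j^2-b_jr_j+a_j)$, where $r_j=\operatorname{sign}(c_j)\lfloor b_j/(2|c_j|)\rfloor$ if $|c_j|\ge\sqrt\Delta$ and $r_j=\operatorname{sign}(c_j)\lfloor (b_j+\sqrt\Delta)/(2|c_j|)\rfloor$ if $|c_j|<\sqrt\Delta$. The cycle of a reduced indefinite form $F$ is the sequence $F_0\sim F_1\sim\dots\sim F_{N-1}$ of length $N$ with $F_0=F$ and, for $F_j=(a_j,b_j,c_j)$, $s_j=\lfloor (b_j+\sqrt\Delta)/(2|c_j|)\rfloor$, $F_{j+1}=(|c_j|,-b_j+2|c_j|s_j,-(c_js_j^2+b_js_j+a_j))$. If $N$ is even, the proper cycle of $F$ is $F_0\sim\tau F_1\sim F_2\sim\tau F_3\sim\dots\sim F_{N-2}\sim\tau F_{N-1}$, of length $N$; if $N$ is odd, it is $F_0\sim\tau F_1\sim F_2\sim\dots\sim\tau F_{N-2}\sim F_{N-1}\sim\tau F_0\sim F_1\sim\tau F_2\sim\dots\sim F_{N-2}\sim\tau F_{N-1}$, of length $2N$.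
   Formalization: Misprints mended. d_2^+: 2nd form (-2c^m,2hc^m,1). d_1^-: 2nd middle coefficient (2h-2)c^m, 3rd form (c^m,2hc^m-2c^m,-2hc^m+c^m+1), needs h,c≥2. d_2^-: 3rd form (2c^m,2hc^m-4c^m,-2hc^m+2c^m+1), 4th middle coefficient 2hc^m-2, needs h≥3. Else false. *)

theory Defs
  imports Complex_Main "HOL-Computational_Algebra.Squarefree"
begin

(* (A, B, C) stands for the form A x^2 + B x y + C y^2. *)
type_synonym qform = "int \<times> int \<times> int"

fun discr :: "qform \<Rightarrow> int" where
  "discr (A, B, C) = B\<^sup>2 - 4 * A * C"

fun tau :: "qform \<Rightarrow> qform" where
  "tau (A, B, C) = (- A, B, - C)"

definition indefinite :: "qform \<Rightarrow> bool" where
  "indefinite F \<longleftrightarrow> discr F > 0"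

fun reduced :: "qform \<Rightarrow> bool" where
  "reduced (A, B, C) \<longleftrightarrow>
     indefinite (A, B, C) \<and>
     \<bar>sqrt (discr (A, B, C)) - 2 * \<bar>real_of_int A\<bar>\<bar> < real_of_int B \<and>
     real_of_int B < sqrt (discr (A, B, C))"

fun rho_coeff :: "qform \<Rightarrow> int" where
  "rho_coeff (a, b, c) =
     (if \<bar>real_of_int c\<bar> \<ge> sqrt (discr (a, b, c))
      then sgn c * \<lfloor>real_of_int b / (2 * \<bar>real_of_int c\<bar>)\<rfloor>
      else sgn c * \<lfloor>(real_of_int b + sqrt (discr (a, b, c))) / (2 * \<bar>real_of_int c\<bar>)\<rfloor>)"

fun rho :: "qform \<Rightarrow> qform" where
  "rho (a, b, c) =
     (let r = rho_coeff (a, b, c) in (c, - b + 2 * c * r, c * r\<^sup>2 - b * r + a))"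

fun cycle_step :: "qform \<Rightarrow> qform" where
  "cycle_step (a, b, c) =
     (let s = \<lfloor>(real_of_int b + sqrt (discr (a, b, c))) / (2 * \<bar>real_of_int c\<bar>)\<rfloor>
      in (\<bar>c\<bar>, - b + 2 * \<bar>c\<bar> * s, - (c * s\<^sup>2 + b * s + a)))"

(* The length N of the cycle is the least positive N with F_N = F_0. *)
definition is_cycle :: "qform \<Rightarrow> qform list \<Rightarrow> bool" where
  "is_cycle F Fs \<longleftrightarrow>
     reduced F \<and> Fs \<noteq> [] \<and>
     (\<forall>j < length Fs. Fs ! j = (cycle_step ^^ j) F) \<and>
     (cycle_step ^^ length Fs) F = F \<and>
     (\<forall>j. 0 < j \<and> j < length Fs \<longrightarrow> (cycle_step ^^ j) F \<noteq> F)"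

definition alternate_tau :: "qform list \<Rightarrow> qform list" where
  "alternate_tau Fs = map (\<lambda>j. if even j then Fs ! j else tau (Fs ! j)) [0..<length Fs]"

(* For odd N, alternating over F_0, ..., F_(N-1), F_0, ..., F_(N-1) flips the parity in the
   second pass: it reads tau F_0, F_1, tau F_2, ..., tau F_(N-1). *)
definition is_proper_cycle :: "qform \<Rightarrow> qform list \<Rightarrow> bool" where
  "is_proper_cycle F Gs \<longleftrightarrow>
     (\<exists>Fs. is_cycle F Fs \<and>
       Gs = (if even (length Fs) then alternate_tau Fs else alternate_tau (Fs @ Fs)))"

definition principal_form :: "int \<Rightarrow> qform" where
  "principal_form d = (1, 0, - d)"

end

theory Submission
  imports Defs
begin

text \<open>
  Put \<open>H = a\<^sup>k b\<^sup>l\<close> and \<open>T = i c\<^sup>m\<close>, so that \<open>d = H\<^sup>2 \<plusminus> T\<close> and \<open>T\<close> divides \<open>2 H\<close>, say \<open>T q = 2 H\<close>.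
  The integer part \<open>w\<close> of \<open>sqrt d\<close> is \<open>H\<close> or \<open>H - 1\<close> respectively, and
  \<open>\<rho>\<^sup>2(1, 0, -d) = (1, 2 w, w\<^sup>2 - d)\<close>. All middle coefficients met in the cycle are even, so each
  partial quotient is an integer part of \<open>(\<beta> + w) / \<bar>\<gamma>\<bar>\<close>. The partial quotients are
  \<open>q, 2 H\<close> in the plus case and \<open>1, q - 2, 1, 2 H - 2\<close> in the minus case.
\<close>

lemma sqrt_int_bounds:
  fixes d w :: int
  assumes "0 \<le> w" "w\<^sup>2 \<le> d" "d < (w + 1)\<^sup>2"
  shows "real_of_int w \<le> sqrt d" "sqrt d < real_of_int w + 1"
proof -
  have "(real_of_int w)\<^sup>2 \<le> real_of_int d"
    using assms(2) by (metis of_int_le_iff of_int_power)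
  then show "real_of_int w \<le> sqrt d"
    by (rule real_le_rsqrt)
  have "real_of_int d < (real_of_int w + 1)\<^sup>2"
    using assms(3) by (metis of_int_1 of_int_add of_int_less_iff of_int_power)
  then show "sqrt d < real_of_int w + 1"
    using assms(1) by (intro real_less_lsqrt) auto
qed

lemma sqrt_four_mult: "sqrt (4 * x) = 2 * sqrt x"
  by (simp add: real_sqrt_mult)

text \<open>Both \<open>b + w\<close> and the multiples of \<open>c\<close> are integers, so raising
  \<open>w\<close> to \<open>sqrt d\<close>, by less than 1, cannot reach the next multiple of
  \<open>c\<close>.\<close>

lemma floor_quadratic_quotient:
  fixes b c d s w :: int
  assumes "0 \<le> w" "w\<^sup>2 \<le> d" "d < (w + 1)\<^sup>2" "0 < c"
    and "s * c \<le> b + w" "b + w < (s + 1) * c"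
  shows "\<lfloor>(2 * real_of_int b + 2 * sqrt d) / (2 * real_of_int c)\<rfloor> = s"
proof -
  have "real_of_int s * c \<le> real_of_int b + w"
    using assms(5) by (metis of_int_add of_int_le_iff of_int_mult)
  moreover have "b + w + 1 \<le> (s + 1) * c"
    using assms(6) by simp
  then have "real_of_int b + w + 1 \<le> (real_of_int s + 1) * c"
    by (metis of_int_1 of_int_add of_int_le_iff of_int_mult)
  ultimately have "real_of_int s * c \<le> b + sqrt d" "b + sqrt d < (real_of_int s + 1) * c"
    using sqrt_int_bounds[OF assms(1-3)] by linarith+
  then show ?thesis
    using assms(4) by (simp add: floor_eq_iff field_simps)
qed

text \<open>The discriminant is \<open>4 * d\<close>, so a factor 2 cancels in the quotient and
  integer inequalities certify \<open>s\<close>. The last entry is written \<open>- c\<close>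
  because every form met in the cycles below has a negative one.\<close>

lemma cycle_step_eq:
  fixes a b c d s w :: int
  assumes w: "0 \<le> w" "w\<^sup>2 \<le> d" "d < (w + 1)\<^sup>2"
    and d: "d = b\<^sup>2 + a * c" and c: "0 < c"
    and s: "s * c \<le> b + w" "b + w < (s + 1) * c"
  shows "cycle_step (a, 2 * b, - c) = (c, 2 * (c * s - b), c * s\<^sup>2 - 2 * b * s - a)"
proof -
  have "discr (a, 2 * b, - c) = 4 * d"
    using d by (simp add: power2_eq_square)
  then have "sqrt (discr (a, 2 * b, - c)) = 2 * sqrt d"
    by (simp add: sqrt_four_mult del: discr.simps)
  then show ?thesis
    using floor_quadratic_quotient[OF w c s] c
    by (simp add: Let_def algebra_simps del: discr.simps)
qed

lemma rho_rho_principal_form: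
  fixes d w :: int
  assumes d: "2 \<le> d" and w: "0 \<le> w" "w\<^sup>2 \<le> d" "d < (w + 1)\<^sup>2"
  shows "(rho ^^ 2) (principal_form d) = (1, 2 * w, w\<^sup>2 - d)"
proof -
  \<comment> \<open>For \<open>d\<close> = 2, 3 the modulus \<open>d\<close> lies below
    \<open>2 * sqrt d\<close>, so the second branch of \<open>rho_coeff\<close> applies; this bound
    makes its floor 0, the value of the first branch.\<close>
  have "sqrt d < d"
    using d by (intro real_less_lsqrt) (auto simp: power2_eq_square)
  then have "\<lfloor>2 * sqrt d / (2 * real_of_int d)\<rfloor> = 0"
    using d by (simp add: floor_eq_iff)
  then have "rho_coeff (1, 0, - d) = 0"
    using d by (simp add: sqrt_four_mult)
  then have 1: "rho (1, 0, - d) = (- d, 0, 1)"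
    by (simp add: Let_def del: rho_coeff.simps)
  have "1 < sqrt d"
    using d by simp
  then have "\<not> 1 \<ge> 2 * sqrt d"
    by linarith
  moreover have "\<lfloor>sqrt d\<rfloor> = w"
    using sqrt_int_bounds[OF w] by (simp add: floor_eq_iff)
  ultimately have "rho_coeff (- d, 0, 1) = w"
    by (simp add: sqrt_four_mult)
  then have "rho (- d, 0, 1) = (1, 2 * w, w\<^sup>2 - d)"
    by (simp add: Let_def del: rho_coeff.simps)
  with 1 show ?thesis
    by (simp add: principal_form_def numeral_2_eq_2 del: rho.simps)
qed

text \<open>Halved, the condition reads |sqrt d - 1| < w < sqrt d, which is w < sqrt d < w + 1
  because sqrt d > 1.\<close>

lemma reduced_principal:
  fixes d w :: int
  assumes w: "1 \<le> w" "w\<^sup>2 < d" "d < (w + 1)\<^sup>2"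
  shows "reduced (1, 2 * w, w\<^sup>2 - d)"
proof -
  have "discr (1, 2 * w, w\<^sup>2 - d) = 4 * d"
    by (simp add: power2_eq_square)
  moreover have "sqrt (real_of_int (4 * d)) = 2 * sqrt d"
    by (simp add: sqrt_four_mult)
  moreover have "0 < d"
    using w(2) zero_le_power2[of w] by linarith
  moreover have "(real_of_int w)\<^sup>2 < real_of_int d"
    using w(2) by (metis of_int_less_iff of_int_power)
  then have "real_of_int w < sqrt d"
    by (rule real_less_rsqrt)
  moreover have "sqrt d < real_of_int w + 1"
    using sqrt_int_bounds(2)[of w d] w by simp
  ultimately show ?thesis
    using w(1) by (simp add: indefinite_def del: discr.simps)
qed

text \<open>For \<open>F = G\<close> the cycle has odd length 1, but its proper cycle is still \<open>F \<sim> \<tau> F\<close>.\<close>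

lemma is_proper_cycle_two:
  assumes "reduced F" "cycle_step F = G" "cycle_step G = F"
  shows "is_proper_cycle F [F, tau G]"
proof (cases "F = G")
  case True
  with assms have "is_cycle F [F]"
    by (auto simp: is_cycle_def)
  then show ?thesis
    using True unfolding is_proper_cycle_def
    by (intro exI[of _ "[F]"]) (simp add: alternate_tau_def)
next
  case False
  with assms have "is_cycle F [F, G]"
    by (auto simp: is_cycle_def less_Suc_eq)
  then show ?thesis
    unfolding is_proper_cycle_def
    by (intro exI[of _ "[F, G]"]) (simp add: alternate_tau_def)
qed

text \<open>The three inequalities make 4 the first return time to \<open>F\<close>.\<close>

lemma is_proper_cycle_four:
  assumes "reduced F" "cycle_step F = G" "cycle_step G = I" "cycle_step I = J" "cycle_step J = F"
    and "G \<noteq> F" "I \<noteq> F" "J \<noteq> F"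
  shows "is_proper_cycle F [F, tau G, I, tau J]"
proof -
  have "is_cycle F [F, G, I, J]"
    using assms by (auto simp: is_cycle_def less_Suc_eq)
  then show ?thesis
    unfolding is_proper_cycle_def
    by (intro exI[of _ "[F, G, I, J]"]) (simp add: alternate_tau_def)
qed

text \<open>The first quotient (H + H) / T equals \<open>q\<close> without remainder, which restores
  the middle coefficient \<open>2 * H\<close>. For \<open>T\<close> = 1 the two cycle forms
  coincide.\<close>

lemma proper_cycle_square_plus:
  fixes H T q :: int
  assumes "0 < H" "0 < T" "T * q = 2 * H"
  shows "is_proper_cycle ((rho ^^ 2) (principal_form (H\<^sup>2 + T)))
    [(1, 2 * H, - T), (- T, 2 * H, 1)]"
proof -
  define d where "d = H\<^sup>2 + T"
  have "0 < q"
    using assms by (smt (verit) mult_nonneg_nonpos)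
  \<comment> \<open>This is what places \<open>d\<close> below
    \<open>(H + 1)\<^sup>2\<close>.\<close>
  then have "T \<le> 2 * H"
    using assms by (smt (verit) mult_le_cancel_left1)
  then have w: "0 \<le> H" "H\<^sup>2 \<le> d" "d < (H + 1)\<^sup>2"
    using assms by (auto simp: d_def power2_eq_square algebra_simps)
  have "1 \<le> H\<^sup>2"
    using assms(1) by (simp add: int_one_le_iff_zero_less)
  then have F: "(rho ^^ 2) (principal_form d) = (1, 2 * H, - T)"
    using assms(2) by (subst rho_rho_principal_form[OF _ w]) (auto simp: d_def)
  have "reduced (1, 2 * H, - T)"
  proof -
    have "1 \<le> H" "H\<^sup>2 < d" "H\<^sup>2 - d = - T"
      using assms by (auto simp: d_def)
    then show ?thesis
      using reduced_principal[of H d] w(3) by metis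
  qed
  moreover have "cycle_step (1, 2 * H, - T) = (T, 2 * H, - 1)"
  proof -
    have "T * q\<^sup>2 = 2 * H * q"
      using assms(3) by (simp add: power2_eq_square flip: mult.assoc)
    then show ?thesis
      using assms by (subst cycle_step_eq[OF w, where s = q])
        (auto simp: d_def algebra_simps)
  qed
  moreover have "cycle_step (T, 2 * H, - 1) = (1, 2 * H, - T)"
    by (subst cycle_step_eq[OF w, where s = "2 * H"])
      (auto simp: d_def power2_eq_square algebra_simps)
  ultimately show ?thesis
    using is_proper_cycle_two F by (fastforce simp: d_def)
qed

text \<open>Here \<open>w = H - 1\<close>. The bound on \<open>q\<close> gives T < H, which keeps
  the first quotient at 1; for \<open>T\<close> = 1 the third form would already be the first
  one.\<close>

lemma proper_cycle_square_minus:
  fixes H T q :: int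
  assumes T: "2 \<le> T" and q: "3 \<le> q" and H: "T * q = 2 * H"
  shows "is_proper_cycle ((rho ^^ 2) (principal_form (H\<^sup>2 - T)))
    [(1, 2 * H - 2, 1 - 2 * H + T), (- 2 * H + T + 1, 2 * H - 2 * T, T),
     (T, 2 * H - 2 * T, - 2 * H + T + 1), (- 2 * H + T + 1, 2 * H - 2, 1)]"
proof -
  define d where "d = H\<^sup>2 - T"
  \<comment> \<open>\<open>N\<close> is \<open>d - (H - 1)\<^sup>2\<close>, the negated last
    coefficient of the initial form.\<close>
  define N where "N = 2 * H - T - 1"
  have "T * 3 \<le> T * q"
    using T q by simp
  then have TH: "3 * T \<le> 2 * H"
    using H by simp
  then have w: "0 \<le> H - 1" "(H - 1)\<^sup>2 \<le> d" "d < (H - 1 + 1)\<^sup>2"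
    using T by (auto simp: d_def power2_eq_square algebra_simps)
  have "3 * H \<le> H\<^sup>2"
    using TH T by (simp add: power2_eq_square)
  then have "2 \<le> d"
    using TH T unfolding d_def by linarith
  then have F: "(rho ^^ 2) (principal_form d) = (1, 2 * (H - 1), - N)"
    by (subst rho_rho_principal_form[OF _ w])
      (auto simp: d_def N_def power2_eq_square algebra_simps)
  have "(H - 1)\<^sup>2 - d = - N"
    by (simp add: d_def N_def power2_eq_square algebra_simps)
  moreover have "1 \<le> H - 1" "(H - 1)\<^sup>2 < d"
    using TH T by (auto simp: d_def power2_eq_square algebra_simps)
  ultimately have red: "reduced (1, 2 * (H - 1), - N)"
    using reduced_principal[of "H - 1" d] w(3) by metis
  have N: "0 < N"
    using TH T by (simp add: N_def)
  have step1: "cycle_step (1, 2 * (H - 1), - N) = (N, 2 * (H - T), - T)"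
    using TH T N by (subst cycle_step_eq[OF w, where s = 1])
      (auto simp: d_def N_def power2_eq_square algebra_simps)
  \<comment> \<open>The numerator (H - T) + (H - 1) equals (q - 1) T - 1, just short of a multiple
    of \<open>T\<close>, so the quotient is \<open>q - 2\<close>.\<close>
  have step2: "cycle_step (N, 2 * (H - T), - T) = (T, 2 * (H - T), - N)"
  proof -
    have "T * (q - 2) = 2 * (H - T)"
      using H by (simp add: algebra_simps)
    moreover from this have "T * (q - 2)\<^sup>2 = 2 * (H - T) * (q - 2)"
      by (simp add: power2_eq_square flip: mult.assoc)
    moreover have "d = (H - T)\<^sup>2 + N * T"
      by (simp add: d_def N_def power2_eq_square algebra_simps)
    moreover have "(q - 2) * T \<le> H - T + (H - 1)" "H - T + (H - 1) < (q - 2 + 1) * T"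
      using H T by (auto simp: algebra_simps)
    ultimately show ?thesis
      using T by (subst cycle_step_eq[OF w, where s = "q - 2"]) simp_all
  qed
  have step3: "cycle_step (T, 2 * (H - T), - N) = (N, 2 * (H - 1), - 1)"
    using TH T N by (subst cycle_step_eq[OF w, where s = 1])
      (auto simp: d_def N_def power2_eq_square algebra_simps)
  have step4: "cycle_step (N, 2 * (H - 1), - 1) = (1, 2 * (H - 1), - N)"
    by (subst cycle_step_eq[OF w, where s = "2 * (H - 1)"])
      (auto simp: d_def N_def power2_eq_square algebra_simps)
  \<comment> \<open>The first coefficients alone separate the later forms from the initial
    one.\<close>
  have "N \<noteq> 1" "T \<noteq> 1"
    using TH T by (auto simp: N_def)
  then have "is_proper_cycle (1, 2 * (H - 1), - N)
      [(1, 2 * (H - 1), - N), tau (N, 2 * (H - T), - T),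
       (T, 2 * (H - T), - N), tau (N, 2 * (H - 1), - 1)]"
    by (intro is_proper_cycle_four red step1 step2 step3 step4) auto
  then show ?thesis
    unfolding d_def[symmetric] F by (simp add: N_def algebra_simps)
qed

text \<open>The lemmas are applied with (T, q) = (c^m, 2h) or (2c^m, h); the bounds on
  \<open>h\<close> and \<open>c\<close> supply q \<ge> 3 and, for T = c^m, T \<ge> 2. In the cycles
  of length 4 the third form has even index, so \<open>tau\<close> leaves its first coefficient
  positive.\<close>

theorem corollary5p5:
  fixes a b c h :: int and k l m :: nat
  assumes "a > 0" and "b > 0" and "c > 0"
    and "k > 0" and "l > 0" and "m > 0"
    and "c dvd a * b" and "k \<ge> m" and "l \<ge> m"
    and "h = (a ^ k * b ^ l) div c ^ m"
  shows "c ^ m dvd a ^ k * b ^ l \<and> h > 0 \<and>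
    (\<forall>d. d = a ^ (2 * k) * b ^ (2 * l) + c ^ m \<and> d > 0 \<and> squarefree d \<longrightarrow>
      is_proper_cycle ((rho ^^ 2) (principal_form d))
        [(1, 2 * h * c ^ m, - (c ^ m)),
         (- (c ^ m), 2 * h * c ^ m, 1)]) \<and>
    (\<forall>d. d = a ^ (2 * k) * b ^ (2 * l) + 2 * c ^ m \<and> d > 0 \<and> squarefree d \<longrightarrow>
      is_proper_cycle ((rho ^^ 2) (principal_form d))
        [(1, 2 * h * c ^ m, - 2 * c ^ m),
         (- 2 * c ^ m, 2 * h * c ^ m, 1)]) \<and>
    (\<forall>d. d = a ^ (2 * k) * b ^ (2 * l) - c ^ m \<and> d > 0 \<and> squarefree d \<and> h \<ge> 2 \<and> c \<ge> 2 \<longrightarrow>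
      is_proper_cycle ((rho ^^ 2) (principal_form d))
        [(1, 2 * h * c ^ m - 2, 1 - (2 * h - 1) * c ^ m),
         (- 2 * h * c ^ m + c ^ m + 1, (2 * h - 2) * c ^ m, c ^ m),
         (c ^ m, 2 * h * c ^ m - 2 * c ^ m, - 2 * h * c ^ m + c ^ m + 1),
         (- 2 * h * c ^ m + c ^ m + 1, 2 * h * c ^ m - 2, 1)]) \<and>
    (\<forall>d. d = a ^ (2 * k) * b ^ (2 * l) - 2 * c ^ m \<and> d > 0 \<and> squarefree d \<and> h \<ge> 3 \<longrightarrow>
      is_proper_cycle ((rho ^^ 2) (principal_form d))
        [(1, 2 * h * c ^ m - 2, 1 - 2 * (h - 1) * c ^ m),
         (- 2 * h * c ^ m + 2 * c ^ m + 1, 2 * (h - 2) * c ^ m, 2 * c ^ m),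
         (2 * c ^ m, 2 * h * c ^ m - 4 * c ^ m, - 2 * h * c ^ m + 2 * c ^ m + 1),
         (- 2 * h * c ^ m + 2 * c ^ m + 1, 2 * h * c ^ m - 2, 1)])"
proof (intro conjI allI impI)
  define H where "H = a ^ k * b ^ l"
  define t where "t = c ^ m"
  \<comment> \<open>The chain passes through \<open>(a * b) ^ m\<close>, using that \<open>k\<close>
    and \<open>l\<close> are at least \<open>m\<close>.\<close>
  have "c ^ m dvd (a * b) ^ m"
    using assms(7) by (rule dvd_power_same)
  also have "(a * b) ^ m dvd a ^ k * b ^ l"
    using assms(8,9) by (simp add: power_mult_distrib le_imp_power_dvd mult_dvd_mono)
  finally show dvd: "c ^ m dvd a ^ k * b ^ l" .
  then have ht: "h * t = H"
    using assms(10) by (simp add: H_def t_def)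
  have H: "0 < H" and t: "0 < t"
    using assms by (auto simp: H_def t_def)
  show h: "0 < h"
    using ht H t by (metis zero_less_mult_pos2)
  have sq: "a ^ (2 * k) * b ^ (2 * l) = H\<^sup>2"
    by (simp add: H_def power_mult_distrib power_mult[symmetric] mult.commute)
  note [simp] = t_def[symmetric] sq

  fix d :: int
  show "is_proper_cycle ((rho ^^ 2) (principal_form d))
      [(1, 2 * h * c ^ m, - (c ^ m)), (- (c ^ m), 2 * h * c ^ m, 1)]"
    if "d = a ^ (2 * k) * b ^ (2 * l) + c ^ m \<and> d > 0 \<and> squarefree d"
  proof -
    have "d = H\<^sup>2 + t"
      using that by simp
    then show ?thesis
      using proper_cycle_square_plus[of H t "2 * h"] H t by (simp add: mult_ac flip: ht)
  qed
  show "is_proper_cycle ((rho ^^ 2) (principal_form d))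
      [(1, 2 * h * c ^ m, - 2 * c ^ m), (- 2 * c ^ m, 2 * h * c ^ m, 1)]"
    if "d = a ^ (2 * k) * b ^ (2 * l) + 2 * c ^ m \<and> d > 0 \<and> squarefree d"
  proof -
    have "d = H\<^sup>2 + 2 * t"
      using that by simp
    then show ?thesis
      using proper_cycle_square_plus[of H "2 * t" h] H t by (simp add: mult_ac flip: ht)
  qed
  show "is_proper_cycle ((rho ^^ 2) (principal_form d))
      [(1, 2 * h * c ^ m - 2, 1 - (2 * h - 1) * c ^ m),
       (- 2 * h * c ^ m + c ^ m + 1, (2 * h - 2) * c ^ m, c ^ m),
       (c ^ m, 2 * h * c ^ m - 2 * c ^ m, - 2 * h * c ^ m + c ^ m + 1),
       (- 2 * h * c ^ m + c ^ m + 1, 2 * h * c ^ m - 2, 1)]"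
    if *: "d = a ^ (2 * k) * b ^ (2 * l) - c ^ m \<and> d > 0 \<and> squarefree d \<and> h \<ge> 2 \<and> c \<ge> 2"
  proof -
    have "c ^ 1 \<le> c ^ m"
      using assms(6) * by (intro power_increasing) auto
    then have "2 \<le> t"
      using * by simp
    moreover have d: "d = H\<^sup>2 - t" and "3 \<le> 2 * h"
      using * by simp_all
    ultimately show ?thesis
      unfolding d using proper_cycle_square_minus[of t "2 * h" H]
      by (simp add: algebra_simps flip: ht)
  qed
  show "is_proper_cycle ((rho ^^ 2) (principal_form d))
      [(1, 2 * h * c ^ m - 2, 1 - 2 * (h - 1) * c ^ m),
       (- 2 * h * c ^ m + 2 * c ^ m + 1, 2 * (h - 2) * c ^ m, 2 * c ^ m),
       (2 * c ^ m, 2 * h * c ^ m - 4 * c ^ m, - 2 * h * c ^ m + 2 * c ^ m + 1),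
       (- 2 * h * c ^ m + 2 * c ^ m + 1, 2 * h * c ^ m - 2, 1)]"
    if *: "d = a ^ (2 * k) * b ^ (2 * l) - 2 * c ^ m \<and> d > 0 \<and> squarefree d \<and> h \<ge> 3"
  proof -
    have d: "d = H\<^sup>2 - 2 * t" and "3 \<le> h"
      using * by simp_all
    then show ?thesis
      unfolding d using proper_cycle_square_minus[of "2 * t" h H] t
      by (simp add: algebra_simps flip: ht)
  qed
qed

end
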